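(* For any fixed $d\in\mathbb{N}$, the problems Uniformity Pareto Pruning, Coverage Pareto Pruning and Directed Coverage Pareto Pruning are each solvable in polynomial time for $d$ approval objectives.
   Context: An instance is given by a finite set $X$, objective functions $f_1,\dots,f_d:X\to\mathbb{R}$, and a positive integer $k$; write $f=(f_1,\dots,f_d)$. An objective $f_i$ is an approval objective if $f_i(x)\in\{0,1\}$ for all $x\in X$. An element $x\in X$ is dominated by $y\in X$ if $f_i(x)\le f_i(y)$ for all $i$ and $f_j(x)<f_j(y)$ for some $j$; $x$ is Pareto optimal if it is dominated by no $y\in X$. The set of alternatives is $A=\{f(x): x\in X,\ x\text{ Pareto optimal}\}\subseteq\mathbb{R}^d$. Let $\|x-y\|=\sum_{i=1}^d|x_i-y_i|$ and $\|x-y\|_+=\sum_{i=1}^d\max(x_i-y_i,0)$. For $S\subseteq A$ put $I_U(S)=\min_{x,y\in S,\,x\ne y}\|x-y\|$ ($+\infty$ if $|S|=1$), $I_C(S,A)=\max_{a\in A}\min_{s\in S}\|a-s\|$, $I_{DC}(S,A)=\max_{a\in A}\min_{s\in S}\|a-s\|_+$. Uniformity (respectively Coverage, Directed Coverage) Pareto Pruning: find $S\subseteq A$ with $|S|=k$ maximizing $I_U(S)$ (respectively minimizing $I_C(S,A)$, minimizing $I_{DC}(S,A)$). *)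

theory Defs
  imports "HOL-Library.Extended_Real" "HOL-Computational_Algebra.Polynomial"
begin

section \<open>Pareto pruning\<close>

text \<open>The objectives are \<open>obj I i\<close> for \<open>i < dim I\<close>; values at other indices are irrelevant.
  Points of $\mathbb{R}^d$ are real lists of length \<open>d\<close>.\<close>

record 'x pruning_instance =
  items :: "'x set"
  dim :: nat
  obj :: "nat \<Rightarrow> 'x \<Rightarrow> real"
  budget :: nat

definition valid_instance :: "'x pruning_instance \<Rightarrow> bool" where
  "valid_instance I \<longleftrightarrow> finite (items I) \<and> budget I > 0"

definition approval_objective :: "'x pruning_instance \<Rightarrow> nat \<Rightarrow> bool" where
  "approval_objective I i \<longleftrightarrow> (\<forall>x\<in>items I. obj I i x \<in> {0, 1})"

definition approval_instances :: "nat \<Rightarrow> 'x pruning_instance set" where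
  "approval_instances d =
     {I. valid_instance I \<and> dim I = d \<and> (\<forall>i<d. approval_objective I i)}"

definition dominated_by :: "'x pruning_instance \<Rightarrow> 'x \<Rightarrow> 'x \<Rightarrow> bool" where
  "dominated_by I x y \<longleftrightarrow>
     (\<forall>i<dim I. obj I i x \<le> obj I i y) \<and> (\<exists>j<dim I. obj I j x < obj I j y)"

definition pareto_optimal :: "'x pruning_instance \<Rightarrow> 'x \<Rightarrow> bool" where
  "pareto_optimal I x \<longleftrightarrow> x \<in> items I \<and> \<not> (\<exists>y\<in>items I. dominated_by I x y)"

definition objective_vector :: "'x pruning_instance \<Rightarrow> 'x \<Rightarrow> real list" where
  "objective_vector I x = map (\<lambda>i. obj I i x) [0..<dim I]"

definition alternatives :: "'x pruning_instance \<Rightarrow> real list set" where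
  "alternatives I = {objective_vector I x | x. x \<in> items I \<and> pareto_optimal I x}"

definition l1_dist :: "nat \<Rightarrow> real list \<Rightarrow> real list \<Rightarrow> real" where
  "l1_dist d x y = (\<Sum>i<d. \<bar>x ! i - y ! i\<bar>)"

definition directed_dist :: "nat \<Rightarrow> real list \<Rightarrow> real list \<Rightarrow> real" where
  "directed_dist d x y = (\<Sum>i<d. max (x ! i - y ! i) 0)"

definition uniformity :: "nat \<Rightarrow> real list set \<Rightarrow> ereal" where
  "uniformity d S =
     (if card S = 1 then \<infinity>
      else ereal (Min {l1_dist d x y | x y. x \<in> S \<and> y \<in> S \<and> x \<noteq> y}))"

definition coverage :: "nat \<Rightarrow> real list set \<Rightarrow> real list set \<Rightarrow> real" where
  "coverage d S A = Max ((\<lambda>a. Min ((\<lambda>s. l1_dist d a s) ` S)) ` A)"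

definition directed_coverage :: "nat \<Rightarrow> real list set \<Rightarrow> real list set \<Rightarrow> real" where
  "directed_coverage d S A = Max ((\<lambda>a. Min ((\<lambda>s. directed_dist d a s) ` S)) ` A)"

definition feasible :: "'x pruning_instance \<Rightarrow> real list set \<Rightarrow> bool" where
  "feasible I S \<longleftrightarrow> S \<subseteq> alternatives I \<and> card S = budget I"

definition uniformity_pareto_pruning ::
    "'x pruning_instance \<Rightarrow> real list set \<Rightarrow> bool" where
  "uniformity_pareto_pruning I S \<longleftrightarrow> feasible I S \<and>
     (\<forall>S'. feasible I S' \<longrightarrow> uniformity (dim I) S' \<le> uniformity (dim I) S)"

definition coverage_pareto_pruning ::
    "'x pruning_instance \<Rightarrow> real list set \<Rightarrow> bool" where
  "coverage_pareto_pruning I S \<longleftrightarrow> feasible I S \<and>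
     (\<forall>S'. feasible I S' \<longrightarrow>
        coverage (dim I) S (alternatives I) \<le> coverage (dim I) S' (alternatives I))"

definition directed_coverage_pareto_pruning ::
    "'x pruning_instance \<Rightarrow> real list set \<Rightarrow> bool" where
  "directed_coverage_pareto_pruning I S \<longleftrightarrow> feasible I S \<and>
     (\<forall>S'. feasible I S' \<longrightarrow>
        directed_coverage (dim I) S (alternatives I)
          \<le> directed_coverage (dim I) S' (alternatives I))"


section \<open>Turing machines and polynomial time\<close>

text \<open>Deterministic machines with a single two-way infinite tape over the fixed input
  alphabet extended by a blank, which is \<open>None\<close>. A machine halts when no transition applies.\<close>

datatype symbol = Bit bool | Sep

datatype move = MLeft | MStay | MRight

fun offset :: "move \<Rightarrow> int" where
  "offset MLeft = -1"
| "offset MStay = 0"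
| "offset MRight = 1"

record turing_machine =
  states :: "nat set"
  start :: nat
  trans :: "nat \<Rightarrow> symbol option \<Rightarrow> (nat \<times> symbol option \<times> move) option"

definition is_turing_machine :: "turing_machine \<Rightarrow> bool" where
  "is_turing_machine M \<longleftrightarrow> finite (states M) \<and> start M \<in> states M \<and>
     (\<forall>q\<in>states M. \<forall>a q' b m. trans M q a = Some (q', b, m) \<longrightarrow> q' \<in> states M)"

text \<open>A configuration consists of the state, the tape and the head position.\<close>

type_synonym config = "nat \<times> (int \<Rightarrow> symbol option) \<times> int"

definition initial_config :: "turing_machine \<Rightarrow> symbol list \<Rightarrow> config" where
  "initial_config M w =
     (start M, \<lambda>j. if 0 \<le> j \<and> j < int (length w) then Some (w ! nat j) else None, 0)"

fun halted :: "turing_machine \<Rightarrow> config \<Rightarrow> bool" where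
  "halted M (q, T, h) \<longleftrightarrow> trans M q (T h) = None"

fun step :: "turing_machine \<Rightarrow> config \<Rightarrow> config" where
  "step M (q, T, h) =
     (case trans M q (T h) of
        None \<Rightarrow> (q, T, h)
      | Some (q', b, m) \<Rightarrow> (q', T(h := b), h + offset m))"

text \<open>The output is the word that starts at the head and extends to the next blank.\<close>

fun has_output :: "config \<Rightarrow> symbol list \<Rightarrow> bool" where
  "has_output (q, T, h) v \<longleftrightarrow>
     (\<forall>j<length v. T (h + int j) = Some (v ! j)) \<and> T (h + int (length v)) = None"

definition computes_within ::
    "turing_machine \<Rightarrow> symbol list \<Rightarrow> nat \<Rightarrow> symbol list \<Rightarrow> bool" where
  "computes_within M w n v \<longleftrightarrow>
     (\<exists>t\<le>n. let c = (step M ^^ t) (initial_config M w) in halted M c \<and> has_output c v)"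

text \<open>A search problem is given by its set of instances, the relation between instances and
  their codes, the relation between instances and their solutions, and the relation between
  solutions and their codes. The first output symbol tells whether a solution exists; if so,
  the code of one solution follows.\<close>

definition solvable_in_poly_time ::
    "'i set \<Rightarrow> ('i \<Rightarrow> symbol list \<Rightarrow> bool) \<Rightarrow> ('i \<Rightarrow> 's \<Rightarrow> bool) \<Rightarrow>
     ('s \<Rightarrow> symbol list \<Rightarrow> bool) \<Rightarrow> bool" where
  "solvable_in_poly_time Inst codes solution sol_codes \<longleftrightarrow>
     (\<exists>M. \<exists>p :: nat poly. is_turing_machine M \<and>
        (\<forall>I\<in>Inst. \<forall>w. codes I w \<longrightarrow>
           (\<exists>v. computes_within M w (poly p (length w)) v \<and>
              (if \<exists>S. solution I S
               then \<exists>S u. solution I S \<and> sol_codes S u \<and> v = Bit True # u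
               else v = [Bit False]))))"


section \<open>Codes for approval instances and for sets of alternatives\<close>

text \<open>Binary representation, most significant bit first.\<close>

fun binary :: "nat \<Rightarrow> bool list" where
  "binary n = (if n = 0 then [] else binary (n div 2) @ [odd n])"

declare binary.simps [simp del]

text \<open>One bit per coordinate; this is a faithful code for vectors with entries in
  \<open>{0, 1}\<close> only.\<close>

definition vector_code :: "real list \<Rightarrow> symbol list" where
  "vector_code v = map (\<lambda>r. Bit (r = 1)) v @ [Sep]"

text \<open>The items may be listed in any order, and distinct items may have the same vector.\<close>

definition instance_code :: "'x pruning_instance \<Rightarrow> symbol list \<Rightarrow> bool" where
  "instance_code I w \<longleftrightarrow>
     (\<exists>xs. distinct xs \<and> set xs = items I \<and>
        w = map Bit (binary (budget I)) @ [Sep] @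
            concat (map (\<lambda>x. vector_code (objective_vector I x)) xs))"

definition alternatives_code :: "real list set \<Rightarrow> symbol list \<Rightarrow> bool" where
  "alternatives_code S u \<longleftrightarrow>
     (\<exists>vs. distinct vs \<and> set vs = S \<and> u = concat (map vector_code vs))"

end

(* For fixed d there are only finitely many vectors in {0,1}^d, so the solutions depend only on a
   bounded amount of information about the instance: the set of its objective vectors and its
   budget, capped at a number above which no set of alternatives is large enough. A finite
   automaton extracts this information in one pass over the code, and a Turing machine simulating
   it only has to write down an answer that is stored in its transition table. *)
theory Submission
  imports Defs
begin

section \<open>Search problems decided by a finite automaton\<close>

text \<open>In state \<open>(q, None)\<close> the machine simulates the automaton. At the first blank it turns to
  \<open>(q, Some n)\<close>, in which the last \<open>n\<close> symbols of \<open>out q\<close> have yet to be replaced by its first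
  \<open>n\<close> symbols: the answer is written from right to left over the end of the input, so that the
  blank behind the input terminates it and the head ends on its first symbol.\<close>

definition writer_trans ::
    "('q \<Rightarrow> symbol \<Rightarrow> 'q) \<Rightarrow> ('q \<Rightarrow> symbol list) \<Rightarrow> 'q \<times> nat option \<Rightarrow> symbol option \<Rightarrow>
     (('q \<times> nat option) \<times> symbol option \<times> move) option" where
  "writer_trans \<delta> out s a =
     (case s of
        (q, None) \<Rightarrow>
          (case a of
             Some c \<Rightarrow> Some ((\<delta> q c, None), Some c, MRight)
           | None \<Rightarrow> Some ((q, Some (length (out q))), None, MLeft))
      | (q, Some 0) \<Rightarrow> None
      | (q, Some (Suc n)) \<Rightarrow>
          Some ((q, Some n), Some (out q ! n), if n = 0 then MStay else MLeft))"

definition writer_states :: "'q set \<Rightarrow> ('q \<Rightarrow> symbol list) \<Rightarrow> ('q \<times> nat option) set" where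
  "writer_states Q out = (SIGMA q:Q. insert None (Some ` {..length (out q)}))"

text \<open>Machine states are natural numbers, so \<open>enc\<close> numbers the structured states;
  all that matters about it is injectivity on \<open>writer_states Q out\<close>.\<close>

definition writer ::
    "'q set \<Rightarrow> 'q \<Rightarrow> ('q \<Rightarrow> symbol \<Rightarrow> 'q) \<Rightarrow> ('q \<Rightarrow> symbol list) \<Rightarrow> ('q \<times> nat option \<Rightarrow> nat) \<Rightarrow>
     turing_machine" where
  "writer Q q0 \<delta> out enc =
     \<lparr>states = enc ` writer_states Q out,
      start = enc (q0, None),
      trans = (\<lambda>n a. map_option (map_prod enc id)
                 (writer_trans \<delta> out (inv_into (writer_states Q out) enc n) a))\<rparr>"

section \<open>Well-formedness of the writing machine\<close>

lemma writer_trans_closed: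
  assumes "\<And>q c. q \<in> Q \<Longrightarrow> \<delta> q c \<in> Q"
    and "s \<in> writer_states Q out" and "writer_trans \<delta> out s a = Some (s', b, m)"
  shows "s' \<in> writer_states Q out"
  using assms
  by (auto simp: writer_states_def writer_trans_def split: option.splits prod.splits nat.splits)

lemma trans_writer:
  assumes "inj_on enc (writer_states Q out)" and "s \<in> writer_states Q out"
  shows "trans (writer Q q0 \<delta> out enc) (enc s) a =
    map_option (map_prod enc id) (writer_trans \<delta> out s a)"
  using assms by (simp add: writer_def)

lemma is_turing_machine_writer:
  assumes "finite Q" and "q0 \<in> Q" and closed: "\<And>q c. q \<in> Q \<Longrightarrow> \<delta> q c \<in> Q"
    and inj: "inj_on enc (writer_states Q out)"
  shows "is_turing_machine (writer Q q0 \<delta> out enc)"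
  unfolding is_turing_machine_def
proof (intro conjI ballI allI impI)
  show "finite (states (writer Q q0 \<delta> out enc))"
    using \<open>finite Q\<close> by (simp add: writer_def writer_states_def)
  show "start (writer Q q0 \<delta> out enc) \<in> states (writer Q q0 \<delta> out enc)"
    using \<open>q0 \<in> Q\<close> by (auto simp: writer_def writer_states_def)
next
  fix n a n' b m
  assume "n \<in> states (writer Q q0 \<delta> out enc)"
    and t: "trans (writer Q q0 \<delta> out enc) n a = Some (n', b, m)"
  then obtain s where s: "s \<in> writer_states Q out" "n = enc s"
    by (auto simp: writer_def)
  then obtain s' where "writer_trans \<delta> out s a = Some (s', b, m)" "n' = enc s'"
    using t by (auto simp: trans_writer[OF inj])
  then show "n' \<in> states (writer Q q0 \<delta> out enc)"
    using writer_trans_closed[OF closed s(1)] by (auto simp: writer_def)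
qed

section \<open>The run of the writing machine\<close>

lemma foldl_closed:
  assumes "\<And>q c. q \<in> Q \<Longrightarrow> \<delta> q c \<in> Q" and "q \<in> Q"
  shows "foldl \<delta> q w \<in> Q"
  using assms(2) by (induction w arbitrary: q) (auto simp: assms(1))

text \<open>One step per input symbol, one at the blank, one per written symbol. With an empty
  answer the head would halt on the cell left of the blank, hence \<open>nonempty\<close>.\<close>

lemma computes_within_writer:
  assumes "q0 \<in> Q" and closed: "\<And>q c. q \<in> Q \<Longrightarrow> \<delta> q c \<in> Q"
    and inj: "inj_on enc (writer_states Q out)"
    and q_def: "q = foldl \<delta> q0 w"
    and nonempty: "out q \<noteq> []"
  shows "computes_within (writer Q q0 \<delta> out enc) w (length w + 1 + length (out q)) (out q)"
proof -
  define M where "M = writer Q q0 \<delta> out enc"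
  define T where "T = (\<lambda>j. if 0 \<le> j \<and> j < int (length w) then Some (w ! nat j) else None)"
  define N where "N = int (length w)"
  define L where "L = length (out q)"
  have Q: "foldl \<delta> q0 u \<in> Q" for u
    using foldl_closed[of Q \<delta>] closed \<open>q0 \<in> Q\<close> by blast
  note trans = trans_writer[OF inj, where ?q0.0 = q0 and \<delta> = \<delta>, folded M_def]
  have init: "initial_config M w = (enc (q0, None), T, 0)"
    by (simp add: initial_config_def M_def writer_def T_def)
  have scan: "(step M ^^ i) (initial_config M w) = (enc (foldl \<delta> q0 (take i w), None), T, int i)"
    if "i \<le> length w" for i
    using that
  proof (induction i)
    case 0
    then show ?case by (simp add: init)
  next
    case (Suc i)
    have T: "T (int i) = Some (w ! i)"
      using Suc.prems by (simp add: T_def)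
    have "(foldl \<delta> q0 (take i w), None) \<in> writer_states Q out"
      using Q by (simp add: writer_states_def)
    moreover have "T(int i := Some (w ! i)) = T"
      using T by auto
    ultimately show ?case
      using Suc T by (simp add: trans writer_trans_def take_Suc_conv_app_nth)
  qed
  \<comment> \<open>After \<open>j\<close> writes the last \<open>j\<close> cells before
    \<open>N\<close> hold the last \<open>j\<close> symbols of \<open>out q\<close>: cell
    \<open>N - i\<close> gets index \<open>L - i\<close>.\<close>
  define tape where
    "tape j = (\<lambda>x. if N - int j \<le> x \<and> x < N then Some (out q ! nat (int L - (N - x))) else T x)"
    for j
  have turn: "(step M ^^ (length w + 1)) (initial_config M w) = (enc (q, Some L), T, N - 1)"
  proof -
    have "T N = None"
      by (simp add: T_def N_def)
    moreover from this have "T(N := None) = T"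
      by auto
    moreover have "(q, None) \<in> writer_states Q out"
      using Q by (simp add: writer_states_def q_def)
    ultimately show ?thesis
      using scan[of "length w"]
      by (simp add: trans writer_trans_def L_def flip: q_def N_def)
  qed
  \<comment> \<open>The last write leaves the head in place, whence the separate position for
    \<open>j = L\<close>.\<close>
  have "(step M ^^ (length w + 1 + j)) (initial_config M w) =
      (enc (q, Some (L - j)), tape j, if j < L then N - 1 - int j else N - int L)"
    if "j \<le> L" for j
    using that
  proof (induction j)
    case 0
    have "tape 0 = T"
      by (auto simp: tape_def fun_eq_iff)
    then show ?case
      using turn nonempty by (simp add: L_def)
  next
    case (Suc j)
    then have IH: "(step M ^^ (length w + 1 + j)) (initial_config M w) =
        (enc (q, Some (Suc (L - Suc j))), tape j, N - 1 - int j)"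
      by (simp add: Suc_diff_Suc)
    have "(q, Some (Suc (L - Suc j))) \<in> writer_states Q out"
      using Q Suc.prems by (auto simp: writer_states_def q_def L_def)
    moreover have "(tape j)(N - 1 - int j := Some (out q ! (L - Suc j))) = tape (Suc j)"
      using Suc.prems by (auto simp: tape_def fun_eq_iff nat_diff_distrib of_nat_diff
          intro!: arg_cong[where f = "\<lambda>n. out q ! n"])
    ultimately show ?case
      using Suc.prems by (simp add: trans writer_trans_def IH[simplified])
  qed
  from this[of L] have final: "(step M ^^ (length w + 1 + L)) (initial_config M w) =
      (enc (q, Some 0), tape L, N - int L)"
    by simp
  have "(q, Some 0) \<in> writer_states Q out"
    using Q by (simp add: writer_states_def q_def)
  then have "halted M (enc (q, Some 0), tape L, N - int L)"
    by (simp add: trans writer_trans_def)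
  moreover have "has_output (enc (q, Some 0), tape L, N - int L) (out q)"
    by (simp add: tape_def T_def N_def L_def)
  ultimately show ?thesis
    unfolding computes_within_def M_def[symmetric] L_def[symmetric] Let_def
    using final by (metis order_refl)
qed

section \<open>From automata to polynomial time\<close>

definition correct_answer ::
    "('i \<Rightarrow> 's \<Rightarrow> bool) \<Rightarrow> ('s \<Rightarrow> symbol list \<Rightarrow> bool) \<Rightarrow> 'i \<Rightarrow> symbol list \<Rightarrow> bool" where
  "correct_answer solution sol_codes I v \<longleftrightarrow>
     (if \<exists>S. solution I S
      then \<exists>S u. solution I S \<and> sol_codes S u \<and> v = Bit True # u
      else v = [Bit False])"

text \<open>Instances whose codes lead to the same state have the same solutions, so one stored
  answer per state suffices. Answer lengths are bounded over the finite \<open>Q\<close>, so the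
  running time is linear.\<close>

lemma solvable_by_finite_automaton:
  assumes "finite Q" and "q0 \<in> Q" and closed: "\<And>q c. q \<in> Q \<Longrightarrow> \<delta> q c \<in> Q"
    and codes: "\<And>I S. I \<in> Inst \<Longrightarrow> solution I S \<Longrightarrow> \<exists>u. sol_codes S u"
    and determined: "\<And>I J w w' S. I \<in> Inst \<Longrightarrow> J \<in> Inst \<Longrightarrow> codes I w \<Longrightarrow> codes J w' \<Longrightarrow>
      foldl \<delta> q0 w = foldl \<delta> q0 w' \<Longrightarrow> solution I S \<longleftrightarrow> solution J S"
  shows "solvable_in_poly_time Inst codes solution sol_codes"
proof -
  have "\<exists>v. v \<noteq> [] \<and> (\<forall>I\<in>Inst. \<forall>w. codes I w \<longrightarrow> foldl \<delta> q0 w = q \<longrightarrow>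
      correct_answer solution sol_codes I v)" for q
  proof (cases "\<exists>I\<in>Inst. \<exists>w. codes I w \<and> foldl \<delta> q0 w = q")
    case True
    \<comment> \<open>An answer for any one instance reaching \<open>q\<close> serves all
      others.\<close>
    then obtain J w' where J: "J \<in> Inst" "codes J w'" "foldl \<delta> q0 w' = q"
      by blast
    obtain v where v: "v \<noteq> []" "correct_answer solution sol_codes J v"
      using codes[OF J(1)] unfolding correct_answer_def by (metis list.discI)
    have "correct_answer solution sol_codes I v"
      if "I \<in> Inst" "codes I w" "foldl \<delta> q0 w = q" for I w
    proof -
      have "solution I = solution J"
        using determined[OF that(1) J(1) that(2) J(2)] that(3) J(3) by (simp add: fun_eq_iff)
      with v(2) show ?thesis
        unfolding correct_answer_def by metis
    qed
    with v(1) show ?thesis by blast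
  next
    case False
    \<comment> \<open>No instance code leads to \<open>q\<close>, so any nonempty word will
      do.\<close>
    then show ?thesis by (intro exI[of _ "[Sep]"]) auto
  qed
  then obtain out where nonempty: "out q \<noteq> []"
    and out: "\<And>I w. I \<in> Inst \<Longrightarrow> codes I w \<Longrightarrow> foldl \<delta> q0 w = q \<Longrightarrow>
      correct_answer solution sol_codes I (out q)" for q
    by metis
  obtain enc :: "_ \<Rightarrow> nat" where inj: "inj_on enc (writer_states Q out)"
    using finite_imp_inj_to_nat_seg[of "writer_states Q out"] \<open>finite Q\<close>
    by (auto simp: writer_states_def)
  define M where "M = writer Q q0 \<delta> out enc"
  define L where "L = Max ((\<lambda>q. length (out q)) ` Q)"
  have "\<exists>v. computes_within M w (poly [:L + 1, 1:] (length w)) v \<and>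
      correct_answer solution sol_codes I v" if "I \<in> Inst" "codes I w" for I w
  proof -
    define q where "q = foldl \<delta> q0 w"
    have "q \<in> Q"
      using foldl_closed[of Q \<delta>] closed \<open>q0 \<in> Q\<close> unfolding q_def by blast
    then have "length (out q) \<le> L"
      using \<open>finite Q\<close> by (simp add: L_def)
    then have "length w + 1 + length (out q) \<le> poly [:L + 1, 1:] (length w)"
      by simp
    moreover have "computes_within M w (length w + 1 + length (out q)) (out q)"
      unfolding M_def
      by (rule computes_within_writer[OF \<open>q0 \<in> Q\<close> closed inj q_def nonempty])
    ultimately have "computes_within M w (poly [:L + 1, 1:] (length w)) (out q)"
      unfolding computes_within_def by (meson order_trans)
    then show ?thesis
      using out[OF that q_def[symmetric]] by blast
  qed
  moreover have "is_turing_machine M"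
    unfolding M_def by (rule is_turing_machine_writer[OF assms(1,2) closed inj])
  ultimately show ?thesis
    unfolding solvable_in_poly_time_def correct_answer_def by blast
qed


section \<open>An automaton for approval instances\<close>

lemma pareto_optimal_iff_objective_vector:
  "pareto_optimal I x \<longleftrightarrow> x \<in> items I \<and>
     \<not> (\<exists>v\<in>objective_vector I ` items I.
          (\<forall>i<dim I. objective_vector I x ! i \<le> v ! i) \<and>
          (\<exists>j<dim I. objective_vector I x ! j < v ! j))"
  by (simp add: pareto_optimal_def dominated_by_def objective_vector_def)

lemma alternatives_eq:
  "alternatives I = {u \<in> objective_vector I ` items I.
     \<not> (\<exists>v\<in>objective_vector I ` items I.
          (\<forall>i<dim I. u ! i \<le> v ! i) \<and> (\<exists>j<dim I. u ! j < v ! j))}"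
  unfolding alternatives_def pareto_optimal_iff_objective_vector by auto

text \<open>Dominance compares objective vectors only, so the items behind them do not
  matter.\<close>

lemma alternatives_cong:
  assumes "dim I = dim J" and "objective_vector I ` items I = objective_vector J ` items J"
  shows "alternatives I = alternatives J"
  unfolding alternatives_eq assms ..

text \<open>The shape is that of \<open>finite_lists_length_le\<close>; lengths below
  \<open>d\<close> cover vectors read only in part.\<close>

abbreviation short_words :: "nat \<Rightarrow> bool list set" where
  "short_words d \<equiv> {bs. set bs \<subseteq> UNIV \<and> length bs \<le> d}"

lemma finite_short_words: "finite (short_words d)"
  by (rule finite_lists_length_le) simp

definition approved :: "'x pruning_instance \<Rightarrow> 'x \<Rightarrow> bool list" where
  "approved I x = map (\<lambda>i. obj I i x = 1) [0..<dim I]"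

lemma objective_vector_approved:
  assumes "I \<in> approval_instances d" and "x \<in> items I"
  shows "objective_vector I x = map of_bool (approved I x)"
  using assms
  by (auto simp: approval_instances_def approval_objective_def objective_vector_def approved_def)

lemma vector_code_objective_vector:
  "vector_code (objective_vector I x) = map Bit (approved I x) @ [Sep]"
  by (simp add: vector_code_def objective_vector_def approved_def)

text \<open>A crude bound that depends on \<open>d\<close> only; it yields the cap on the
  budget.\<close>

lemma card_alternatives:
  assumes "I \<in> approval_instances d"
  shows "finite (alternatives I)" and "card (alternatives I) \<le> card (short_words d)"
proof -
  have sub: "alternatives I \<subseteq> map of_bool ` short_words d"
  proof
    fix v assume "v \<in> alternatives I"
    then obtain x where "x \<in> items I" "v = objective_vector I x"
      by (auto simp: alternatives_def)
    then have "v = map of_bool (approved I x)"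
      using objective_vector_approved[OF assms] by simp
    moreover have "approved I x \<in> short_words d"
      using assms by (simp add: approved_def approval_instances_def)
    ultimately show "v \<in> map of_bool ` short_words d"
      by blast
  qed
  show "finite (alternatives I)"
    using sub finite_short_words by (rule finite_subset[OF _ finite_imageI])
  show "card (alternatives I) \<le> card (short_words d)"
    using surj_card_le[OF finite_short_words sub] .
qed

text \<open>The first component is the budget read so far, capped at \<open>K\<close>. The second one is \<open>None\<close>
  until the budget has been read; then it holds the vectors read so far and the part of the
  current vector that has been read.\<close>

type_synonym reader_state = "nat \<times> (bool list set \<times> bool list) option"

fun reader_step :: "nat \<Rightarrow> nat \<Rightarrow> reader_state \<Rightarrow> symbol \<Rightarrow> reader_state" where
  "reader_step d K (k, None) (Bit b) = (min K (2 * k + of_bool b), None)"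
| "reader_step d K (k, None) Sep = (k, Some ({}, []))"
| "reader_step d K (k, Some (V, r)) (Bit b) = (k, Some (V, take d (r @ [b])))"
| "reader_step d K (k, Some (V, r)) Sep = (k, Some (insert r V, []))"

definition reader_states :: "nat \<Rightarrow> nat \<Rightarrow> reader_state set" where
  "reader_states d K =
     {..K} \<times> insert None (Some ` (Pow (short_words d) \<times> short_words d))"

lemma finite_reader_states: "finite (reader_states d K)"
  unfolding reader_states_def using finite_short_words by (intro finite_SigmaI) auto

text \<open>Holds for every symbol, even off the codes, because \<open>reader_step\<close> caps the
  budget at \<open>K\<close> and truncates the current vector to length \<open>d\<close>.\<close>

lemma reader_step_closed:
  "s \<in> reader_states d K \<Longrightarrow> reader_step d K s c \<in> reader_states d K"
  by (cases "(d, K, s, c)" rule: reader_step.cases) (auto simp: reader_states_def)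

section \<open>Runs of the reader on codes\<close>

lemma foldl_reader_step_binary:
  "foldl (reader_step d K) (0, None) (map Bit (binary n)) = (min K n, None)"
proof (induction n rule: less_induct)
  case (less n)
  show ?case
  proof (cases "n = 0")
    case True
    then show ?thesis by (simp add: binary.simps)
  next
    case False
    then have "foldl (reader_step d K) (0, None) (map Bit (binary n)) =
        (min K (2 * min K (n div 2) + of_bool (odd n)), None)"
      using less.IH[of "n div 2"] by (subst binary.simps) simp
    \<comment> \<open>Horner's rule survives early capping: if \<open>n div 2\<close> is at least
      \<open>K\<close>, both sides equal \<open>K\<close>.\<close>
    also have "min K (2 * min K (n div 2) + of_bool (odd n)) = min K n"
      by (cases "even n") (auto simp: min_def elim!: evenE oddE)
    finally show ?thesis .
  qed
qed

text \<open>The length bound keeps \<open>take d\<close> from cutting anything off.\<close>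

lemma foldl_reader_step_bits:
  "length r + length bs \<le> d \<Longrightarrow>
     foldl (reader_step d K) (k, Some (V, r)) (map Bit bs) = (k, Some (V, r @ bs))"
  by (induction bs arbitrary: r) simp_all

lemma foldl_reader_step_items:
  assumes "dim I = d"
  shows "foldl (reader_step d K) (k, Some (V, []))
      (concat (map (\<lambda>x. vector_code (objective_vector I x)) xs)) =
    (k, Some (V \<union> approved I ` set xs, []))"
proof (induction xs arbitrary: V)
  case (Cons x xs)
  have "length (approved I x) = d"
    using assms by (simp add: approved_def)
  then show ?case
    using Cons.IH by (simp add: vector_code_objective_vector foldl_reader_step_bits)
qed simp

text \<open>The final state forgets the order and multiplicity of the listed vectors.\<close>

lemma foldl_reader_step_instance_code:
  assumes "dim I = d" and "instance_code I w"
  shows "foldl (reader_step d K) (0, None) w =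
    (min K (budget I), Some (approved I ` items I, []))"
  using assms
  by (auto simp: instance_code_def foldl_reader_step_binary foldl_reader_step_items)

section \<open>Pruning problems\<close>

text \<open>By \<open>cong\<close>, the problem sees only dimension, budget and alternatives. The
  final state of the reader determines these unless the budget is at least \<open>K\<close>, and
  then there is no solution.\<close>

lemma pruning_solvable_in_poly_time:
  fixes problem :: "'x pruning_instance \<Rightarrow> real list set \<Rightarrow> bool"
  assumes feasible: "\<And>I S. problem I S \<Longrightarrow> feasible I S"
    and cong: "\<And>I J S. dim I = dim J \<Longrightarrow> budget I = budget J \<Longrightarrow>
      alternatives I = alternatives J \<Longrightarrow> problem I S \<Longrightarrow> problem J S"
  shows "solvable_in_poly_time (approval_instances d) instance_code problem alternatives_code"
proof -
  \<comment> \<open>One more than the bound on the number of alternatives, so that a budget of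
    \<open>K\<close> or more is infeasible.\<close>
  define K where "K = Suc (card (short_words d))"
  have bounded: "budget I < K" if "I \<in> approval_instances d" "problem I S" for I S
    using feasible[OF that(2)] card_alternatives[OF that(1)] card_mono[of "alternatives I" S]
    by (simp add: feasible_def K_def)
  \<comment> \<open>One direction, from a given solution: instances without solutions may share a
    state and yet differ in budget.\<close>
  have transfer: "problem J S"
    if I: "I \<in> approval_instances d" "instance_code I w"
      and J: "J \<in> approval_instances d" "instance_code J w'"
      and eq: "foldl (reader_step d K) (0, None) w = foldl (reader_step d K) (0, None) w'"
      and S: "problem I S" for I J w w' S
  proof -
    have dims: "dim I = d" "dim J = d"
      using I J by (simp_all add: approval_instances_def)
    have budgets: "min K (budget I) = min K (budget J)"
      and approved: "approved I ` items I = approved J ` items J"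
      using eq dims foldl_reader_step_instance_code[OF _ I(2)]
        foldl_reader_step_instance_code[OF _ J(2)] by simp_all
    have vectors: "objective_vector I ` items I = map of_bool ` approved I ` items I"
      if "I \<in> approval_instances d" for I :: "'x pruning_instance"
      using objective_vector_approved[OF that] by (simp add: image_image)
    have "alternatives I = alternatives J"
      using alternatives_cong dims vectors[OF I(1)] vectors[OF J(1)] approved by metis
    \<comment> \<open>The common capped value is \<open>budget I\<close>, which is below
      \<open>K\<close>, so the cap does not affect \<open>J\<close> either.\<close>
    moreover have "budget I = budget J"
      using budgets bounded[OF I(1) S] by simp
    ultimately show ?thesis
      using cong[of I J S] dims S by simp
  qed
  show ?thesis
  proof (rule solvable_by_finite_automaton)
    show "finite (reader_states d K)"
      by (rule finite_reader_states)
    show "(0, None) \<in> reader_states d K"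
      by (simp add: reader_states_def)
    show "reader_step d K s c \<in> reader_states d K" if "s \<in> reader_states d K" for s c
      using that by (rule reader_step_closed)
    show "\<exists>u. alternatives_code S u" if "I \<in> approval_instances d" "problem I S" for I S
    proof -
      have "finite S"
        using feasible[OF that(2)] card_alternatives(1)[OF that(1)]
        by (auto simp: feasible_def intro: finite_subset)
      then show ?thesis
        unfolding alternatives_code_def using finite_distinct_list[of S] by blast
    qed
    show "problem I S \<longleftrightarrow> problem J S"
      if "I \<in> approval_instances d" "J \<in> approval_instances d"
        "instance_code I w" "instance_code J w'"
        "foldl (reader_step d K) (0, None) w = foldl (reader_step d K) (0, None) w'" for I J w w' S
      using transfer[OF that(1,3,2,4,5)] transfer[OF that(2,4,1,3) that(5)[symmetric]] by blast
  qed
qed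

theorem proposition11:
  fixes d :: nat
  shows
    "solvable_in_poly_time (approval_instances d :: 'x pruning_instance set)
       instance_code uniformity_pareto_pruning alternatives_code \<and>
     solvable_in_poly_time (approval_instances d :: 'x pruning_instance set)
       instance_code coverage_pareto_pruning alternatives_code \<and>
     solvable_in_poly_time (approval_instances d :: 'x pruning_instance set)
       instance_code directed_coverage_pareto_pruning alternatives_code"
  \<comment> \<open>Each problem mentions \<open>I\<close> only through \<open>dim I\<close>,
    \<open>alternatives I\<close> and, via \<open>feasible\<close>, \<open>budget I\<close>.\<close>
  by (intro conjI pruning_solvable_in_poly_time)
    (simp_all add: uniformity_pareto_pruning_def coverage_pareto_pruning_def
      directed_coverage_pareto_pruning_def feasible_def)

end
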